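(* Assume strong duality holds for $\mathcal{UC}^{\mathrm{CPP}}$, i.e. $\mathcal{UC}^{\mathrm{CPP}}$ and its dual $\mathcal{UC}^{\mathrm{COP}}$ have equal optimal values (and the dual optimum is attained), and let $(\mathbf{x}^*,X^* )$, $X^*=\mathbf{x}^*\mathbf{x}^{*\top}$, be the optimal solution of $\mathcal{UC}^{\mathrm{CPP}}$ used by the copositive duality pricing (CDP) mechanism. If $X^{vw*}_{g_1t,g_2t}=0$ for all variable types $v,w$, all $g_1\neq g_2$ in $\mathcal{G}$ and all $t\in\mathcal{T}$, then the market mechanism with CDP is individually rational; that is, for every generator $g\in\mathcal{G}$, the portion $\mathbf{x}^*_g$ of $\mathbf{x}^*$ belonging to $g$ is an optimal solution of generator $g$'s profit-maximization problem.
   Context: **Cones.** Let $\mathcal{S}_n$ be the real symmetric $n\times n$ matrices, $\mathcal{C}_n=\{X\in\mathcal{S}_n: y^\top Xy\ge 0\ \forall y\in\mathbb{R}^n_+\}$ the copositive cone and $\mathcal{C}_n^*=\{XX^\top : X\in\mathbb{R}^{n\times r}_+ \text{ for some } r\}$ the completely positive cone. **Unit commitment problem $\mathcal{UC}$.** $\mathcal{G}$ is a finite set of generators, $\mathcal{T}$ a finite set of time periods; $c^p_g,c^u_g,d_t$ are real data (production cost, startup cost, load). The decision vector $\mathbf{x}\in\mathbb{R}^n_+$ has components $u_{gt}$ (startup), $z_{gt}$ (on/off), $p_{gt}$ (production) and slack variables $\psi_{jgt}$ ($g\in\mathcal{G}$, $t\in\mathcal{T}$, $j=1,\dots,m$).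 $\mathbf{x}_g$ is the subvector of components belonging to generator $g$. $\mathcal{UC}$ is $$\min \sum_{g,t}(c^p_gp_{gt}+c^u_gu_{gt})\ \text{ s.t. }\ \sum_{g}p_{gt}=d_t\ \forall t;\quad \mathbf{a}_{jgt}^\top\mathbf{x}=b_{jgt}\ \forall j,g,t;\quad z_{gt}\in\{0,1\}\ \forall g,t;\quad \mathbf{x}\ge 0 .$$ The constraints $\mathbf{a}_{jgt}^\top \mathbf{x}=b_{jgt}$ are operational constraints of the individual generator $g$: $\mathbf{a}_{jgt}$ is supported on the components of $\mathbf{x}_g$. The linear constraints together with $\mathbf{x}\ge0$ imply $0\le z_{gt}\le1$. Let $\mathbf{c}\in\mathbb{R}^n$ be the cost vector, so the objective is $\mathbf{c}^\top\mathbf{x}$, and let $\mathbf{h}_t\in\mathbb{R}^n$ satisfy $\mathbf{h}_t^\top\mathbf{x}=\sum_gp_{gt}$. **Completely positive reformulation $\mathcal{UC}^{\mathrm{CPP}}$.** Variables $\mathbf{x}\in\mathbb{R}^n$, $X\in\mathcal{S}_n$. $X^{vw}_{k,q}$ denotes the entry of $X$ in the row of variable $v_k$ and column of variable $w_q$ (e.g. $X^{pp}_{gt,g't}$); so $X^{vw}_{g_1t,g_2t}$ ranges over entries pairing any period-$t$ variable of generator $g_1$ with any period-$t$ variable of generator $g_2$. $Z_{gt}=X^{zz}_{gt,gt}$. The problem is $$\min\ \mathbf{c}^\top\mathbf{x}\ \text{ s.t. }\ \mathbf{h}_t^\top\mathbf{x}=d_t,\ \ \mathbf{a}_{jgt}^\top\mathbf{x}=b_{jgt},\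 \ \mathrm{Tr}(\mathbf{h}_t\mathbf{h}_t^\top X)=d_t^2,\ \ \mathrm{Tr}(\mathbf{a}_{jgt}\mathbf{a}_{jgt}^\top X)=b_{jgt}^2,\ \ z_{gt}=Z_{gt},\ \ Y=\begin{bmatrix}1&\mathbf{x}^\top\\ \mathbf{x}&X\end{bmatrix}\in\mathcal{C}^*_{n+1},$$ for all $j,g,t$. The constraints have dual variables $\lambda_t,\phi_{jgt},\Lambda_t,\Phi_{jgt},\delta_{gt},\Omega$ respectively. By a theorem of Burer (2009), $\mathcal{UC}$ and $\mathcal{UC}^{\mathrm{CPP}}$ have the same optimal value. **Dual $\mathcal{UC}^{\mathrm{COP}}$.** For $\mathbf{a}\in\mathbb{R}^n$ put $A(\mathbf{a})=\begin{bmatrix}0&\frac12\mathbf{a}^\top\\ \frac12\mathbf{a}&0\end{bmatrix}$, $\tilde A(\mathbf{a})=\begin{bmatrix}0\\ \mathbf{a}\end{bmatrix}\begin{bmatrix}0&\mathbf{a}^\top\end{bmatrix}$, both in $\mathcal{S}_{n+1}$. If $k$ is the index of $z_{gt}$ in $\mathbf{x}$, let $B_{gt}\in\mathcal{S}_{n+1}$ have entries $\frac12$ at positions $(k+1,1)$ and $(1,k+1)$, $-1$ at $(k+1,k+1)$, and $0$ elsewhere. Then $\mathcal{UC}^{\mathrm{COP}}$ is $$\max\ \sum_{t}\Big(d_t\lambda_t+d_t^2\Lambda_t+\sum_{j,g}(b_{jgt}\phi_{jgt}+b_{jgt}^2\Phi_{jgt})\Big)$$ $$\text{s.t. } A(\mathbf{c})-\sum_t\lambda_tA(\mathbf{h}_t)-\sum_{j,g,t}\phi_{jgt}A(\mathbf{a}_{jgt})-\sum_t\Lambda_t\tilde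 A(\mathbf{h}_t)-\sum_{j,g,t}\Phi_{jgt}\tilde A(\mathbf{a}_{jgt})-\sum_{g,t}\delta_{gt}B_{gt}-\Omega=0,\quad \Omega\in\mathcal{C}_{n+1},$$ with all other dual variables free real. **CDP mechanism.** Let $\mathbf{x}^*$ be an optimal solution of $\mathcal{UC}$ and $X^*=\mathbf{x}^*\mathbf{x}^{*\top}$; then $(\mathbf{x}^*,X^* )$ is optimal for $\mathcal{UC}^{\mathrm{CPP}}$. Let $(\lambda^*,\phi^*,\Lambda^*,\Phi^* )$ be (part of) an optimal solution of $\mathcal{UC}^{\mathrm{COP}}$. At hour $t$ the system operator pays generator $g$ $$\pi^{\mathrm G}_{gt}=\lambda_t^*p^*_{gt}+\Lambda_t^*X^{pp*}_{gt,gt}+\sum_{j=1}^m\left(\phi^*_{jgt}\mathbf{a}_{jgt}^\top\mathbf{x}^*+\Phi^*_{jgt}\mathrm{Tr}(\mathbf{a}_{jgt}\mathbf{a}_{jgt}^\top X^* )\right)+\sum_{g'\ne g}f_{gg't},$$ where the shares $f_{gg't}$ are real numbers with $f_{gg't}+f_{g'gt}=2\Lambda_t^*X^{pp*}_{gt,g't}$ for $g\ne g'$, and $f_{gg't}=0$ whenever $X^{pp*}_{gt,g't}=0$. **Generator $g$'s profit-maximization problem.** With prices $\lambda^*,\phi^*,\Lambda^*,\Phi^*$ and shares $f_{gg't}$ fixed as in the CDP mechanism: $$\max_{\mathbf{x}_g}\ \sum_{t\in\mathcal{T}}\Big(\lambda^*_tp_{gt}+\Lambda^*_tp_{gt}^2+\sum_{j=1}^m(\phi^*_{jgt}b_{jgt}+\Phi^*_{jgt}b_{jgt}^2)+\sum_{g'\neq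 g}f_{gg't}-c^p_gp_{gt}-c^u_gu_{gt}\Big)$$ subject to $\mathbf{a}_{jgt}^\top\mathbf{x}=b_{jgt}$ for all $j,t$ (which involves only $\mathbf{x}_g$), $z_{gt}\in\{0,1\}$ for all $t$, and $\mathbf{x}_g\ge0$. *)

theory Defs
  imports "HOL-Analysis.Analysis"
begin

section \<open>Copositive and completely positive matrices\<close>

definition nonneg_vec :: "real ^ 'n \<Rightarrow> bool" where
  "nonneg_vec x \<longleftrightarrow> (\<forall>i. 0 \<le> x $ i)"

definition symmetric_mat :: "real ^ 'n ^ 'n \<Rightarrow> bool" where
  "symmetric_mat X \<longleftrightarrow> transpose X = X"

definition outer :: "real ^ 'm \<Rightarrow> real ^ 'n \<Rightarrow> real ^ 'n ^ 'm" where
  "outer a b = (\<chi> i j. a $ i * b $ j)"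

definition copositive_cone :: "(real ^ 'n ^ 'n) set" where
  "copositive_cone = {X. symmetric_mat X \<and> (\<forall>y. nonneg_vec y \<longrightarrow> 0 \<le> y \<bullet> (X *v y))}"

text \<open>The factor \<open>W\<close> is a nonnegative matrix with \<open>r\<close> columns; since \<open>r\<close> is existentially
  quantified, its columns are indexed by natural numbers below \<open>r\<close>, and the entries below
  are those of \<open>W\<close> times its transpose.\<close>

definition completely_positive_cone :: "(real ^ 'n ^ 'n) set" where
  "completely_positive_cone = {X. \<exists>(r::nat) (W :: 'n \<Rightarrow> nat \<Rightarrow> real).
     (\<forall>i. \<forall>k<r. 0 \<le> W i k) \<and> X = (\<chi> i j. \<Sum>k<r. W i k * W j k)}"


section \<open>The unit commitment problem\<close>

text \<open>A component of the decision vector is addressed by \<open>(v, g, t)\<close>: its variable type \<open>v\<close>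
  (\<open>u\<close>, \<open>z\<close>, \<open>p\<close> or \<open>\<psi>\<^sub>j\<close>), generator and time period. Generators, time periods and
  operational constraint numbers \<open>j\<close> are the elements of the finite types \<open>'g\<close>, \<open>'t\<close>, \<open>'j\<close>.\<close>

datatype 'j var_type = Startup | OnOff | Production | Slack 'j

instance var_type :: (finite) finite
proof
  have eq: "(UNIV :: 'a var_type set) = {Startup, OnOff, Production} \<union> range Slack"
    using var_type.exhaust by auto
  show "finite (UNIV :: 'a var_type set)"
    by (subst eq) simp
qed

type_synonym ('j, 'g, 't) var = "'j var_type \<times> 'g \<times> 't"

record ('j, 'g, 't) uc_data =
  prod_cost :: "'g \<Rightarrow> real"
  startup_cost :: "'g \<Rightarrow> real"
  load :: "'t \<Rightarrow> real"
  op_lhs :: "'j \<Rightarrow> 'g \<Rightarrow> 't \<Rightarrow> real ^ ('j, 'g, 't) var"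
  op_rhs :: "'j \<Rightarrow> 'g \<Rightarrow> 't \<Rightarrow> real"

definition cost_vec ::
  "('j::finite, 'g::finite, 't::finite) uc_data \<Rightarrow> real ^ ('j, 'g, 't) var" where
  "cost_vec D = (\<chi> i. case i of (v, g, t) \<Rightarrow>
     (case v of Production \<Rightarrow> prod_cost D g | Startup \<Rightarrow> startup_cost D g
        | OnOff \<Rightarrow> 0 | Slack j \<Rightarrow> 0))"

definition load_vec :: "'t \<Rightarrow> real ^ ('j::finite, 'g::finite, 't::finite) var" where
  "load_vec t = (\<chi> i. case i of (v, g, s) \<Rightarrow> if v = Production \<and> s = t then 1 else 0)"

lemma sum_var_split:
  fixes F :: "('j::finite, 'g::finite, 't::finite) var \<Rightarrow> real"
  shows "sum F UNIV = (\<Sum>v\<in>UNIV. \<Sum>g\<in>UNIV. \<Sum>t\<in>UNIV. F (v, g, t))"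
  by (simp add: sum.cartesian_product flip: UNIV_Times_UNIV)

lemma sum_var_type_split:
  fixes F :: "'j::finite var_type \<Rightarrow> real"
  shows "sum F UNIV = F Startup + F OnOff + F Production + (\<Sum>j\<in>UNIV. F (Slack j))"
proof -
  have eq: "(UNIV :: 'j var_type set) = {Startup, OnOff, Production} \<union> range Slack"
    using var_type.exhaust by auto
  have "sum F UNIV = sum F {Startup, OnOff, Production} + sum F (range Slack)"
    by (subst eq, rule sum.union_disjoint) auto
  moreover have "sum F (range Slack) = (\<Sum>j\<in>UNIV. F (Slack j))"
    by (subst sum.reindex) (auto intro: injI)
  ultimately show ?thesis
    by simp
qed

lemma load_vec_inner:
  "load_vec t \<bullet> x = (\<Sum>g\<in>UNIV. x $ (Production, g, t))"
  by (simp add: inner_vec_def sum_var_split sum_var_type_split load_vec_def if_distribR if_distrib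
      cong: if_cong)

definition linear_constraints ::
  "('j::finite, 'g::finite, 't::finite) uc_data \<Rightarrow> real ^ ('j, 'g, 't) var \<Rightarrow> bool" where
  "linear_constraints D x \<longleftrightarrow>
     (\<forall>t. load_vec t \<bullet> x = load D t) \<and>
     (\<forall>j g t. op_lhs D j g t \<bullet> x = op_rhs D j g t)"

definition uc_instance :: "('j::finite, 'g::finite, 't::finite) uc_data \<Rightarrow> bool" where
  "uc_instance D \<longleftrightarrow>
     (\<forall>j g t v g' s. g' \<noteq> g \<longrightarrow> op_lhs D j g t $ (v, g', s) = 0) \<and>
     (\<forall>x. linear_constraints D x \<and> nonneg_vec x \<longrightarrow>
        (\<forall>g t. 0 \<le> x $ (OnOff, g, t) \<and> x $ (OnOff, g, t) \<le> 1))"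

definition uc_cost ::
  "('j::finite, 'g::finite, 't::finite) uc_data \<Rightarrow> real ^ ('j, 'g, 't) var \<Rightarrow> real" where
  "uc_cost D x = (\<Sum>g\<in>UNIV. \<Sum>t\<in>UNIV.
     prod_cost D g * x $ (Production, g, t) + startup_cost D g * x $ (Startup, g, t))"

lemma cost_vec_inner: "cost_vec D \<bullet> x = uc_cost D x"
  by (simp add: inner_vec_def sum_var_split sum_var_type_split cost_vec_def uc_cost_def
      sum.distrib)

definition uc_feasible ::
  "('j::finite, 'g::finite, 't::finite) uc_data \<Rightarrow> real ^ ('j, 'g, 't) var \<Rightarrow> bool" where
  "uc_feasible D x \<longleftrightarrow>
     (\<forall>t. (\<Sum>g\<in>UNIV. x $ (Production, g, t)) = load D t) \<and>
     (\<forall>j g t. op_lhs D j g t \<bullet> x = op_rhs D j g t) \<and>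
     (\<forall>g t. x $ (OnOff, g, t) \<in> {0, 1}) \<and> nonneg_vec x"

definition uc_optimal ::
  "('j::finite, 'g::finite, 't::finite) uc_data \<Rightarrow> real ^ ('j, 'g, 't) var \<Rightarrow> bool" where
  "uc_optimal D x \<longleftrightarrow>
     uc_feasible D x \<and> (\<forall>x'. uc_feasible D x' \<longrightarrow> uc_cost D x \<le> uc_cost D x')"


section \<open>The completely positive reformulation\<close>

text \<open>Matrices of size one larger than the decision vector are indexed by the option type:
  \<open>None\<close> is the additional first row and column.\<close>

definition bordered :: "real ^ 'n \<Rightarrow> real ^ 'n ^ 'n \<Rightarrow> real ^ ('n option) ^ ('n option)" where
  "bordered x X = (\<chi> i j. case i of
       None \<Rightarrow> (case j of None \<Rightarrow> 1 | Some l \<Rightarrow> x $ l)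
     | Some k \<Rightarrow> (case j of None \<Rightarrow> x $ k | Some l \<Rightarrow> X $ k $ l))"

definition cpp_feasible ::
  "('j::finite, 'g::finite, 't::finite) uc_data \<Rightarrow> real ^ ('j, 'g, 't) var
     \<Rightarrow> real ^ ('j, 'g, 't) var ^ ('j, 'g, 't) var \<Rightarrow> bool" where
  "cpp_feasible D x X \<longleftrightarrow>
     symmetric_mat X \<and>
     (\<forall>t. load_vec t \<bullet> x = load D t) \<and>
     (\<forall>j g t. op_lhs D j g t \<bullet> x = op_rhs D j g t) \<and>
     (\<forall>t. trace (outer (load_vec t) (load_vec t) ** X) = (load D t)\<^sup>2) \<and>
     (\<forall>j g t. trace (outer (op_lhs D j g t) (op_lhs D j g t) ** X) = (op_rhs D j g t)\<^sup>2) \<and>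
     (\<forall>g t. x $ (OnOff, g, t) = X $ (OnOff, g, t) $ (OnOff, g, t)) \<and>
     bordered x X \<in> completely_positive_cone"

definition cpp_optimal ::
  "('j::finite, 'g::finite, 't::finite) uc_data \<Rightarrow> real ^ ('j, 'g, 't) var
     \<Rightarrow> real ^ ('j, 'g, 't) var ^ ('j, 'g, 't) var \<Rightarrow> bool" where
  "cpp_optimal D x X \<longleftrightarrow>
     cpp_feasible D x X \<and>
     (\<forall>x' X'. cpp_feasible D x' X' \<longrightarrow> cost_vec D \<bullet> x \<le> cost_vec D \<bullet> x')"

definition cpp_value :: "('j::finite, 'g::finite, 't::finite) uc_data \<Rightarrow> ereal" where
  "cpp_value D = (INF (x, X) \<in> {(x, X). cpp_feasible D x X}. ereal (cost_vec D \<bullet> x))"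


section \<open>The copositive dual\<close>

definition border_zero :: "real ^ 'n \<Rightarrow> real ^ ('n option)" where
  "border_zero a = (\<chi> i. case i of None \<Rightarrow> 0 | Some k \<Rightarrow> a $ k)"

definition A_lin :: "real ^ 'n \<Rightarrow> real ^ ('n option) ^ ('n option)" where
  "A_lin a = (\<chi> i j. case i of
       None \<Rightarrow> (case j of None \<Rightarrow> 0 | Some l \<Rightarrow> a $ l / 2)
     | Some k \<Rightarrow> (case j of None \<Rightarrow> a $ k / 2 | Some l \<Rightarrow> 0))"

definition A_quad :: "real ^ 'n \<Rightarrow> real ^ ('n option) ^ ('n option)" where
  "A_quad a = outer (border_zero a) (border_zero a)"

definition B_bin ::
  "'g \<Rightarrow> 't \<Rightarrow> real ^ (('j::finite, 'g::finite, 't::finite) var option)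
                 ^ (('j, 'g, 't) var option)" where
  "B_bin g t = (\<chi> i j.
     let k = Some (OnOff, g, t) in
     if (i = k \<and> j = None) \<or> (i = None \<and> j = k) then 1 / 2
     else if i = k \<and> j = k then - 1 else 0)"

text \<open>The fields stand for \<open>\<lambda>\<close>, \<open>\<phi>\<close>, \<open>\<Lambda>\<close>, \<open>\<Phi>\<close>, \<open>\<delta>\<close> and \<open>\<Omega>\<close>.\<close>

record ('j, 'g, 't) uc_dual =
  lam :: "'t \<Rightarrow> real"
  phi :: "'j \<Rightarrow> 'g \<Rightarrow> 't \<Rightarrow> real"
  Lam :: "'t \<Rightarrow> real"
  Phi :: "'j \<Rightarrow> 'g \<Rightarrow> 't \<Rightarrow> real"
  del :: "'g \<Rightarrow> 't \<Rightarrow> real"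
  Omg :: "real ^ (('j, 'g, 't) var option) ^ (('j, 'g, 't) var option)"

definition cop_feasible ::
  "('j::finite, 'g::finite, 't::finite) uc_data \<Rightarrow> ('j, 'g, 't) uc_dual \<Rightarrow> bool" where
  "cop_feasible D q \<longleftrightarrow>
     A_lin (cost_vec D)
       - (\<Sum>t\<in>UNIV. lam q t *\<^sub>R A_lin (load_vec t))
       - (\<Sum>j\<in>UNIV. \<Sum>g\<in>UNIV. \<Sum>t\<in>UNIV. phi q j g t *\<^sub>R A_lin (op_lhs D j g t))
       - (\<Sum>t\<in>UNIV. Lam q t *\<^sub>R A_quad (load_vec t))
       - (\<Sum>j\<in>UNIV. \<Sum>g\<in>UNIV. \<Sum>t\<in>UNIV. Phi q j g t *\<^sub>R A_quad (op_lhs D j g t))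
       - (\<Sum>g\<in>UNIV. \<Sum>t\<in>UNIV. del q g t *\<^sub>R B_bin g t)
       - Omg q = 0 \<and>
     Omg q \<in> copositive_cone"

definition cop_objective ::
  "('j::finite, 'g::finite, 't::finite) uc_data \<Rightarrow> ('j, 'g, 't) uc_dual \<Rightarrow> real" where
  "cop_objective D q = (\<Sum>t\<in>UNIV. load D t * lam q t + (load D t)\<^sup>2 * Lam q t +
     (\<Sum>j\<in>UNIV. \<Sum>g\<in>UNIV. op_rhs D j g t * phi q j g t + (op_rhs D j g t)\<^sup>2 * Phi q j g t))"

definition cop_optimal ::
  "('j::finite, 'g::finite, 't::finite) uc_data \<Rightarrow> ('j, 'g, 't) uc_dual \<Rightarrow> bool" where
  "cop_optimal D q \<longleftrightarrow>
     cop_feasible D q \<and> (\<forall>q'. cop_feasible D q' \<longrightarrow> cop_objective D q' \<le> cop_objective D q)"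

definition cop_value :: "('j::finite, 'g::finite, 't::finite) uc_data \<Rightarrow> ereal" where
  "cop_value D = (SUP q \<in> {q. cop_feasible D q}. ereal (cop_objective D q))"

definition strong_duality :: "('j::finite, 'g::finite, 't::finite) uc_data \<Rightarrow> bool" where
  "strong_duality D \<longleftrightarrow> cpp_value D = cop_value D \<and> (\<exists>q. cop_optimal D q)"


section \<open>Copositive duality pricing\<close>

definition cdp_shares ::
  "real ^ ('j::finite, 'g::finite, 't::finite) var ^ ('j, 'g, 't) var
     \<Rightarrow> ('j, 'g, 't) uc_dual \<Rightarrow> ('g \<Rightarrow> 'g \<Rightarrow> 't \<Rightarrow> real) \<Rightarrow> bool" where
  "cdp_shares X q f \<longleftrightarrow> (\<forall>g g' t. g \<noteq> g' \<longrightarrow>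
     f g g' t + f g' g t = 2 * Lam q t * X $ (Production, g, t) $ (Production, g', t) \<and>
     (X $ (Production, g, t) $ (Production, g', t) = 0 \<longrightarrow> f g g' t = 0))"

definition cdp_mechanism ::
  "('j::finite, 'g::finite, 't::finite) uc_data \<Rightarrow> real ^ ('j, 'g, 't) var
     \<Rightarrow> real ^ ('j, 'g, 't) var ^ ('j, 'g, 't) var
     \<Rightarrow> ('j, 'g, 't) uc_dual \<Rightarrow> ('g \<Rightarrow> 'g \<Rightarrow> 't \<Rightarrow> real) \<Rightarrow> bool" where
  "cdp_mechanism D x X q f \<longleftrightarrow>
     uc_optimal D x \<and> X = outer x x \<and> cop_optimal D q \<and> cdp_shares X q f"

definition cdp_payment ::
  "('j::finite, 'g::finite, 't::finite) uc_data \<Rightarrow> real ^ ('j, 'g, 't) var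
     \<Rightarrow> real ^ ('j, 'g, 't) var ^ ('j, 'g, 't) var
     \<Rightarrow> ('j, 'g, 't) uc_dual \<Rightarrow> ('g \<Rightarrow> 'g \<Rightarrow> 't \<Rightarrow> real) \<Rightarrow> 'g \<Rightarrow> 't \<Rightarrow> real" where
  "cdp_payment D x X q f g t =
     lam q t * x $ (Production, g, t)
     + Lam q t * X $ (Production, g, t) $ (Production, g, t)
     + (\<Sum>j\<in>UNIV. phi q j g t * (op_lhs D j g t \<bullet> x)
          + Phi q j g t * trace (outer (op_lhs D j g t) (op_lhs D j g t) ** X))
     + (\<Sum>g'\<in>UNIV - {g}. f g g' t)"


section \<open>The generators' profit maximization problems\<close>

definition gen_part ::
  "'g \<Rightarrow> real ^ ('j::finite, 'g::finite, 't::finite) var \<Rightarrow> real ^ ('j var_type \<times> 't)" where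
  "gen_part g x = (\<chi> i. case i of (v, t) \<Rightarrow> x $ (v, g, t))"

text \<open>As the operational constraints of \<open>g\<close> are supported on the components of \<open>g\<close>, their
  left-hand sides are inner products with the part of the coefficient vector belonging to \<open>g\<close>.\<close>

definition gen_feasible ::
  "('j::finite, 'g::finite, 't::finite) uc_data \<Rightarrow> 'g \<Rightarrow> real ^ ('j var_type \<times> 't) \<Rightarrow> bool" where
  "gen_feasible D g y \<longleftrightarrow>
     (\<forall>j t. gen_part g (op_lhs D j g t) \<bullet> y = op_rhs D j g t) \<and>
     (\<forall>t. y $ (OnOff, t) \<in> {0, 1}) \<and> nonneg_vec y"

definition gen_profit ::
  "('j::finite, 'g::finite, 't::finite) uc_data \<Rightarrow> ('j, 'g, 't) uc_dual
     \<Rightarrow> ('g \<Rightarrow> 'g \<Rightarrow> 't \<Rightarrow> real) \<Rightarrow> 'g \<Rightarrow> real ^ ('j var_type \<times> 't) \<Rightarrow> real" where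
  "gen_profit D q f g y = (\<Sum>t\<in>UNIV.
     lam q t * y $ (Production, t) + Lam q t * (y $ (Production, t))\<^sup>2
     + (\<Sum>j\<in>UNIV. phi q j g t * op_rhs D j g t + Phi q j g t * (op_rhs D j g t)\<^sup>2)
     + (\<Sum>g'\<in>UNIV - {g}. f g g' t)
     - prod_cost D g * y $ (Production, t) - startup_cost D g * y $ (Startup, t))"

definition gen_optimal ::
  "('j::finite, 'g::finite, 't::finite) uc_data \<Rightarrow> ('j, 'g, 't) uc_dual
     \<Rightarrow> ('g \<Rightarrow> 'g \<Rightarrow> 't \<Rightarrow> real) \<Rightarrow> 'g \<Rightarrow> real ^ ('j var_type \<times> 't) \<Rightarrow> bool" where
  "gen_optimal D q f g y \<longleftrightarrow>
     gen_feasible D g y \<and>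
     (\<forall>y'. gen_feasible D g y' \<longrightarrow> gen_profit D q f g y' \<le> gen_profit D q f g y)"

definition individually_rational ::
  "('j::finite, 'g::finite, 't::finite) uc_data \<Rightarrow> real ^ ('j, 'g, 't) var
     \<Rightarrow> ('j, 'g, 't) uc_dual \<Rightarrow> ('g \<Rightarrow> 'g \<Rightarrow> 't \<Rightarrow> real) \<Rightarrow> bool" where
  "individually_rational D x q f \<longleftrightarrow> (\<forall>g. gen_optimal D q f g (gen_part g x))"

text \<open>At the market solution, the profit is what the operator pays minus the generator's costs.\<close>

lemma gen_profit_eq_payment_minus_cost:
  assumes "cpp_feasible D x (outer x x)"
  shows "gen_profit D q f g (gen_part g x) =
    (\<Sum>t\<in>UNIV. cdp_payment D x (outer x x) q f g t
       - (prod_cost D g * x $ (Production, g, t) + startup_cost D g * x $ (Startup, g, t)))"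
  using assms
  by (simp add: gen_profit_def cdp_payment_def cpp_feasible_def gen_part_def outer_def
      power2_eq_square algebra_simps)

end

theory Submission
  imports Defs
begin

text \<open>Evaluate the quadratic form of the dual matrix \<open>\<Omega>\<close> at \<open>(1, x)\<close>. By dual feasibility the
  result is the cost of \<open>x\<close> minus all revenues that the dual prices attach to it, its
  reduced cost; copositivity makes it nonnegative for every \<open>x \<ge> 0\<close>, whether or not \<open>x\<close> satisfies
  any constraint (\<open>reduced_cost_nonneg\<close>). At the market solution \<open>x\<^sup>*\<close> the revenues add up to
  the dual objective, so strong duality says that the reduced cost of \<open>x\<^sup>*\<close> is zero
  (\<open>reduced_cost_optimal\<close>).

  The only terms of the reduced cost that couple different generators are the products
  \<open>p\<^sub>g\<^sub>t p\<^sub>h\<^sub>t\<close> with \<open>g \<noteq> h\<close> inside the squared load constraints. The assumption on \<open>X\<^sup>*\<close> makes them vanish at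
  \<open>x\<^sup>*\<close>, so the reduced cost of \<open>x\<^sup>*\<close> is the sum of the reduced costs of the single parts
  \<open>x\<^sup>*\<^sub>g\<close>, each padded with zeros for the other generators (\<open>reduced_cost_split\<close>). These summands
  are nonnegative and add up to zero, so each of them is zero.

  For a schedule \<open>y\<close> that is feasible for \<open>g\<close> alone, the profit is a constant, the shares,
  minus the reduced cost of \<open>y\<close> padded with zeros (\<open>gen_profit_eq_reduced_cost\<close>). Hence the
  profit never exceeds the shares, and \<open>x\<^sup>*\<^sub>g\<close> attains them.

  Padding with zeros is essential: if the other generators kept their schedules from \<open>x\<^sup>*\<close>, a
  deviation \<open>y\<close> could create products \<open>p\<^sub>g\<^sub>t p\<^sup>*\<^sub>h\<^sub>t\<close> with \<open>\<Lambda>\<^sub>t\<close> of either sign, which the profit of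
  \<open>g\<close> does not contain. The padded vector may violate the load constraints, but copositivity of
  \<open>\<Omega>\<close> does not ask for them.\<close>

section \<open>Quadratic forms on homogenized vectors\<close>

definition quad_form :: "real ^ 'n ^ 'n \<Rightarrow> real ^ ('n::finite) \<Rightarrow> real" where
  "quad_form M y = y \<bullet> (M *v y)"

definition homogenize :: "real ^ 'n \<Rightarrow> real ^ ('n option)" where
  "homogenize x = (\<chi> i. case i of None \<Rightarrow> 1 | Some k \<Rightarrow> x $ k)"

lemma quad_form_add: "quad_form (M + N) y = quad_form M y + quad_form N y"
  by (simp add: quad_form_def matrix_vector_mult_add_rdistrib inner_add_right)

lemma quad_form_diff: "quad_form (M - N) y = quad_form M y - quad_form N y"
  by (metis add_diff_cancel_right' diff_add_cancel quad_form_add)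

lemma quad_form_scaleR: "quad_form (c *\<^sub>R M) y = c * quad_form M y"
  by (simp add: quad_form_def scaleR_matrix_vector_assoc[symmetric])

lemma quad_form_zero: "quad_form 0 y = 0"
  by (simp add: quad_form_def)

lemma quad_form_sum: "quad_form (\<Sum>i\<in>I. M i) y = (\<Sum>i\<in>I. quad_form (M i) y)"
  by (induction I rule: infinite_finite_induct) (simp_all add: quad_form_add quad_form_zero)

lemma quad_form_entries: "quad_form M y = (\<Sum>i\<in>UNIV. \<Sum>j\<in>UNIV. y $ i * M $ i $ j * y $ j)"
  by (simp add: quad_form_def inner_vec_def matrix_vector_mult_def sum_distrib_left mult.assoc)

lemma sum_option_split:
  fixes F :: "'a::finite option \<Rightarrow> real"
  shows "sum F UNIV = F None + (\<Sum>k\<in>UNIV. F (Some k))"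
  by (simp add: UNIV_option_conv sum.reindex)

lemma quad_form_outer: "quad_form (outer a a) y = (a \<bullet> y)\<^sup>2"
  by (simp add: quad_form_entries outer_def inner_vec_def power2_eq_square sum_product ac_simps)

lemma quad_form_A_quad: "quad_form (A_quad a) (homogenize x) = (a \<bullet> x)\<^sup>2"
proof -
  have "border_zero a \<bullet> homogenize x = a \<bullet> x"
    by (simp add: inner_vec_def border_zero_def homogenize_def sum_option_split)
  then show ?thesis
    by (simp add: A_quad_def quad_form_outer)
qed

lemma quad_form_A_lin: "quad_form (A_lin a) (homogenize x) = a \<bullet> x"
proof -
  have "quad_form (A_lin a) (homogenize x)
      = (\<Sum>k\<in>UNIV. a $ k / 2 * x $ k) + (\<Sum>k\<in>UNIV. x $ k * (a $ k / 2))"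
    by (simp add: quad_form_entries A_lin_def homogenize_def sum_option_split)
  also have "\<dots> = a \<bullet> x"
    by (simp add: inner_vec_def flip: sum.distrib)
  finally show ?thesis .
qed

text \<open>This is how the dual sees the binary constraint: the form vanishes exactly if
  \<open>z\<^sub>g\<^sub>t\<close> is zero or one, so that the multipliers \<open>\<delta>\<close> do not affect the reduced cost of an
  integral schedule.\<close>

lemma quad_form_B_bin:
  fixes x :: "real ^ ('j::finite, 'g::finite, 't::finite) var"
  shows "quad_form (B_bin g t) (homogenize x) = x $ (OnOff, g, t) - (x $ (OnOff, g, t))\<^sup>2"
proof -
  let ?k = "(OnOff, g, t) :: ('j, 'g, 't) var"
  have entries: "B_bin g t $ None $ None = 0"
    "B_bin g t $ None $ Some l = (if l = ?k then 1 / 2 else 0)"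
    "B_bin g t $ Some i $ None = (if i = ?k then 1 / 2 else 0)"
    "B_bin g t $ Some i $ Some l = (if i = ?k then if l = ?k then - 1 else 0 else 0)" for i l
    by (simp_all add: B_bin_def Let_def)
  have block: "(\<Sum>l\<in>UNIV. x $ i * (if i = ?k then if l = ?k then - 1 else 0 else 0) * x $ l)
      = (if i = ?k then - (x $ ?k)\<^sup>2 else 0)" for i
    by (simp add: power2_eq_square if_distrib[of "\<lambda>c. c * _"] if_distrib[of "\<lambda>c. _ * c"]
        cong: if_cong)
  have "quad_form (B_bin g t) (homogenize x)
      = (\<Sum>l\<in>UNIV. (if l = ?k then 1 / 2 else 0) * x $ l)
        + (\<Sum>i\<in>UNIV. x $ i * (if i = ?k then 1 / 2 else 0)
            + (\<Sum>l\<in>UNIV. x $ i * (if i = ?k then if l = ?k then - 1 else 0 else 0) * x $ l))"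
    unfolding quad_form_entries sum_option_split entries by (simp add: homogenize_def)
  also have "\<dots> = x $ ?k - (x $ ?k)\<^sup>2"
    unfolding block sum.distrib
    by (simp add: if_distrib[of "\<lambda>c. c * _"] if_distrib[of "\<lambda>c. _ * c"] cong: if_cong)
  finally show ?thesis .
qed

lemma sum_rotate3:
  fixes F :: "'a \<Rightarrow> 'b \<Rightarrow> 'c \<Rightarrow> real"
  shows "(\<Sum>a\<in>A. \<Sum>b\<in>B. \<Sum>g\<in>G. F a b g) = (\<Sum>g\<in>G. \<Sum>a\<in>A. \<Sum>b\<in>B. F a b g)"
  by (rule trans[OF sum.cong[OF refl sum.swap] sum.swap])

lemma sum_rotate4:
  fixes F :: "'a \<Rightarrow> 'b \<Rightarrow> 'c \<Rightarrow> 'd \<Rightarrow> real"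
  shows "(\<Sum>a\<in>A. \<Sum>b\<in>B. \<Sum>c\<in>C. \<Sum>g\<in>G. F a b c g)
    = (\<Sum>g\<in>G. \<Sum>a\<in>A. \<Sum>b\<in>B. \<Sum>c\<in>C. F a b c g)"
  by (rule trans[OF sum.cong[OF refl sum_rotate3] sum.swap])

section \<open>The reduced cost of a decision vector\<close>

text \<open>The cost of \<open>x\<close> minus the values of all linear and squared constraint functions at \<open>x\<close>,
  priced by the dual multipliers. Since the constraint functions, and not the right-hand sides, are
  priced, it makes sense for vectors that violate the constraints.\<close>

definition reduced_cost ::
  "('j::finite, 'g::finite, 't::finite) uc_data \<Rightarrow> ('j, 'g, 't) uc_dual
     \<Rightarrow> real ^ ('j, 'g, 't) var \<Rightarrow> real" where
  "reduced_cost D q x = cost_vec D \<bullet> x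
     - (\<Sum>t\<in>UNIV. lam q t * (load_vec t \<bullet> x) + Lam q t * (load_vec t \<bullet> x)\<^sup>2)
     - (\<Sum>j\<in>UNIV. \<Sum>g\<in>UNIV. \<Sum>t\<in>UNIV.
          phi q j g t * (op_lhs D j g t \<bullet> x) + Phi q j g t * (op_lhs D j g t \<bullet> x)\<^sup>2)
     - (\<Sum>g\<in>UNIV. \<Sum>t\<in>UNIV. del q g t * (x $ (OnOff, g, t) - (x $ (OnOff, g, t))\<^sup>2))"

lemma quad_form_Omg:
  assumes "cop_feasible D q"
  shows "quad_form (Omg q) (homogenize x) = reduced_cost D q x"
proof -
  have Omg: "Omg q = A_lin (cost_vec D)
       - (\<Sum>t\<in>UNIV. lam q t *\<^sub>R A_lin (load_vec t))
       - (\<Sum>j\<in>UNIV. \<Sum>g\<in>UNIV. \<Sum>t\<in>UNIV. phi q j g t *\<^sub>R A_lin (op_lhs D j g t))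
       - (\<Sum>t\<in>UNIV. Lam q t *\<^sub>R A_quad (load_vec t))
       - (\<Sum>j\<in>UNIV. \<Sum>g\<in>UNIV. \<Sum>t\<in>UNIV. Phi q j g t *\<^sub>R A_quad (op_lhs D j g t))
       - (\<Sum>g\<in>UNIV. \<Sum>t\<in>UNIV. del q g t *\<^sub>R B_bin g t)"
    using assms by (simp add: cop_feasible_def)
  show ?thesis
    unfolding Omg
    by (simp add: quad_form_diff quad_form_sum quad_form_scaleR quad_form_A_lin quad_form_A_quad
        quad_form_B_bin reduced_cost_def sum.distrib)
qed

lemma reduced_cost_nonneg:
  assumes "cop_feasible D q" "nonneg_vec x"
  shows "0 \<le> reduced_cost D q x"
proof -
  have "nonneg_vec (homogenize x)"
    using assms(2) by (auto simp: nonneg_vec_def homogenize_def split: option.split)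
  then have "0 \<le> quad_form (Omg q) (homogenize x)"
    using assms(1) by (auto simp: cop_feasible_def copositive_cone_def quad_form_def)
  then show ?thesis
    by (simp add: quad_form_Omg[OF assms(1)])
qed

lemma reduced_cost_feasible:
  assumes "uc_feasible D x"
  shows "reduced_cost D q x = cost_vec D \<bullet> x - cop_objective D q"
proof -
  have "x $ (OnOff, g, t) - (x $ (OnOff, g, t))\<^sup>2 = 0" for g t
  proof -
    have "x $ (OnOff, g, t) \<in> {0, 1}"
      using assms by (simp add: uc_feasible_def)
    then show ?thesis
      by auto
  qed
  moreover have "load_vec t \<bullet> x = load D t" for t
    using assms by (simp add: uc_feasible_def load_vec_inner)
  moreover have "op_lhs D j g t \<bullet> x = op_rhs D j g t" for j g t
    using assms by (simp add: uc_feasible_def)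
  moreover have "(\<Sum>j\<in>UNIV. \<Sum>g\<in>UNIV. \<Sum>t\<in>UNIV. F j g t) = (\<Sum>t\<in>UNIV. \<Sum>j\<in>UNIV. \<Sum>g\<in>UNIV. F j g t)"
    for F :: "'a \<Rightarrow> 'b \<Rightarrow> 'c \<Rightarrow> real"
    by (rule sum_rotate3)
  ultimately show ?thesis
    by (simp add: reduced_cost_def cop_objective_def sum.distrib mult.commute)
qed

text \<open>Strong duality speaks of an infimum and a supremum; for attained optima it becomes an
  equation between two real numbers.\<close>

lemma cpp_value_optimal:
  assumes "cpp_optimal D x X"
  shows "cpp_value D = ereal (cost_vec D \<bullet> x)"
  unfolding cpp_value_def
proof (rule antisym)
  show "(INF (x, X)\<in>{(x, X). cpp_feasible D x X}. ereal (cost_vec D \<bullet> x)) \<le> ereal (cost_vec D \<bullet> x)"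
    using assms by (intro INF_lower2[of "(x, X)"]) (auto simp: cpp_optimal_def)
  show "ereal (cost_vec D \<bullet> x) \<le> (INF (x, X)\<in>{(x, X). cpp_feasible D x X}. ereal (cost_vec D \<bullet> x))"
    using assms by (intro INF_greatest) (auto simp: cpp_optimal_def)
qed

lemma cop_value_optimal:
  assumes "cop_optimal D q"
  shows "cop_value D = ereal (cop_objective D q)"
  unfolding cop_value_def
proof (rule antisym)
  show "(SUP q\<in>{q. cop_feasible D q}. ereal (cop_objective D q)) \<le> ereal (cop_objective D q)"
    using assms by (intro SUP_least) (auto simp: cop_optimal_def)
  show "ereal (cop_objective D q) \<le> (SUP q\<in>{q. cop_feasible D q}. ereal (cop_objective D q))"
    using assms by (intro SUP_upper2[of q]) (auto simp: cop_optimal_def)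
qed

text \<open>Complementary slackness: the completely positive matrix of rank one built from \<open>x\<close> is
  orthogonal to \<open>\<Omega>\<close>.\<close>

lemma reduced_cost_optimal:
  assumes "strong_duality D" "cpp_optimal D x X" "cop_optimal D q" "uc_feasible D x"
  shows "reduced_cost D q x = 0"
  using assms cpp_value_optimal[OF assms(2)] cop_value_optimal[OF assms(3)]
  by (simp add: strong_duality_def reduced_cost_feasible)

section \<open>Splitting the reduced cost over the generators\<close>

text \<open>The right inverse of \<open>gen_part g\<close> that shuts down every other generator.\<close>

definition embed_gen ::
  "'g \<Rightarrow> real ^ ('j var_type \<times> 't) \<Rightarrow> real ^ ('j::finite, 'g::finite, 't::finite) var" where
  "embed_gen g y = (\<chi> i. case i of (v, g', t) \<Rightarrow> if g' = g then y $ (v, t) else 0)"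

lemma embed_gen_nth [simp]: "embed_gen g y $ (v, g', t) = (if g' = g then y $ (v, t) else 0)"
  by (simp add: embed_gen_def)

lemma nonneg_embed_gen: "nonneg_vec y \<Longrightarrow> nonneg_vec (embed_gen g y)"
  by (simp add: nonneg_vec_def split_paired_all)

lemma sum_embed_gen_part: "(\<Sum>g\<in>UNIV. embed_gen g (gen_part g x)) = x"
  by (simp add: vec_eq_iff gen_part_def)

lemma load_vec_embed_gen: "load_vec t \<bullet> embed_gen g y = y $ (Production, t)"
  by (simp add: load_vec_inner)

lemma cost_vec_embed_gen:
  "cost_vec D \<bullet> embed_gen g y =
     (\<Sum>t\<in>UNIV. prod_cost D g * y $ (Production, t) + startup_cost D g * y $ (Startup, t))"
proof -
  have "(\<Sum>t\<in>UNIV. prod_cost D g' * embed_gen g y $ (Production, g', t)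
            + startup_cost D g' * embed_gen g y $ (Startup, g', t))
      = (if g' = g then \<Sum>t\<in>UNIV. prod_cost D g * y $ (Production, t)
            + startup_cost D g * y $ (Startup, t) else 0)" for g'
    by simp
  then show ?thesis
    by (simp add: cost_vec_inner uc_cost_def del: embed_gen_nth)
qed

lemma op_lhs_embed_gen:
  assumes "uc_instance D"
  shows "op_lhs D j g' t \<bullet> embed_gen g y = (if g' = g then gen_part g (op_lhs D j g t) \<bullet> y else 0)"
proof -
  have *: "op_lhs D j g' t \<bullet> embed_gen g y
      = (\<Sum>v\<in>UNIV. \<Sum>s\<in>UNIV. op_lhs D j g' t $ (v, g, s) * y $ (v, s))"
  proof -
    have "(\<Sum>s\<in>UNIV. op_lhs D j g' t $ (v, h, s) * embed_gen g y $ (v, h, s))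
       = (if h = g then \<Sum>s\<in>UNIV. op_lhs D j g' t $ (v, g, s) * y $ (v, s) else 0)" for v h
      by simp
    then show ?thesis
      by (simp add: inner_vec_def sum_var_split del: embed_gen_nth)
  qed
  show ?thesis
  proof (cases "g' = g")
    case True
    have "gen_part g (op_lhs D j g t) \<bullet> y
        = (\<Sum>v\<in>UNIV. \<Sum>s\<in>UNIV. op_lhs D j g t $ (v, g, s) * y $ (v, s))"
      by (simp add: inner_vec_def gen_part_def sum.cartesian_product case_prod_beta
          flip: UNIV_Times_UNIV)
    then show ?thesis
      unfolding * using True by simp
  next
    case False
    then have "op_lhs D j g' t $ (v, g, s) = 0" for v s
      using assms unfolding uc_instance_def by metis
    then show ?thesis
      using False by (simp add: *)
  qed
qed

lemma sum_square_orthogonal: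
  fixes r :: "'a \<Rightarrow> real"
  assumes "finite I" "\<And>g h. g \<in> I \<Longrightarrow> h \<in> I \<Longrightarrow> g \<noteq> h \<Longrightarrow> r g * r h = 0"
  shows "(\<Sum>g\<in>I. r g)\<^sup>2 = (\<Sum>g\<in>I. (r g)\<^sup>2)"
proof -
  have "(\<Sum>h\<in>I. r g * r h) = (r g)\<^sup>2" if "g \<in> I" for g
  proof -
    have "(\<Sum>h\<in>I. r g * r h) = (\<Sum>h\<in>I. if h = g then (r g)\<^sup>2 else 0)"
      using assms that by (intro sum.cong) (auto simp: power2_eq_square)
    then show ?thesis
      using assms(1) that by simp
  qed
  then show ?thesis
    by (simp add: power2_eq_square sum_product)
qed

text \<open>Everything except the squared loads separates for any \<open>x\<close>: the linear terms by linearity,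
  the operational constraints and the binary terms because each of them involves only one
  generator. For the squared loads \<open>orth\<close> removes the mixed products.\<close>

lemma reduced_cost_split:
  assumes "uc_instance D"
    and orth: "\<And>g h t. g \<noteq> h \<Longrightarrow> x $ (Production, g, t) * x $ (Production, h, t) = 0"
  shows "reduced_cost D q x = (\<Sum>g\<in>UNIV. reduced_cost D q (embed_gen g (gen_part g x)))"
proof -
  define y where "y = (\<lambda>g. embed_gen g (gen_part g x))"
  have split: "a \<bullet> x = (\<Sum>g\<in>UNIV. a \<bullet> y g)" for a
    unfolding y_def by (simp add: sum_embed_gen_part flip: inner_sum_right)
  have load2: "(load_vec t \<bullet> x)\<^sup>2 = (\<Sum>g\<in>UNIV. (load_vec t \<bullet> y g)\<^sup>2)" for t
    unfolding split y_def using orth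
    by (intro sum_square_orthogonal) (simp_all add: load_vec_embed_gen gen_part_def)
  have op2: "(op_lhs D j h t \<bullet> x)\<^sup>2 = (\<Sum>g\<in>UNIV. (op_lhs D j h t \<bullet> y g)\<^sup>2)" for j h t
    unfolding split y_def
    by (intro sum_square_orthogonal) (simp_all add: op_lhs_embed_gen[OF assms(1)])
  have bin: "x $ (OnOff, h, t) - (x $ (OnOff, h, t))\<^sup>2
      = (\<Sum>g\<in>UNIV. y g $ (OnOff, h, t) - (y g $ (OnOff, h, t))\<^sup>2)" for h t
  proof -
    have "y g $ (OnOff, h, t) - (y g $ (OnOff, h, t))\<^sup>2
        = (if h = g then x $ (OnOff, h, t) - (x $ (OnOff, h, t))\<^sup>2 else 0)" for g
      by (simp add: y_def gen_part_def)
    then show ?thesis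
      by simp
  qed
  have load: "(\<Sum>t\<in>UNIV. lam q t * (load_vec t \<bullet> x) + Lam q t * (load_vec t \<bullet> x)\<^sup>2)
      = (\<Sum>g\<in>UNIV. \<Sum>t\<in>UNIV. lam q t * (load_vec t \<bullet> y g) + Lam q t * (load_vec t \<bullet> y g)\<^sup>2)"
    (* Two steps: the squares must be split before the inner products inside them. *)
    unfolding load2
    unfolding split[of "load_vec _"]
    by (subst sum.swap) (simp add: sum_distrib_left sum.distrib)
  have op: "(\<Sum>j\<in>UNIV. \<Sum>h\<in>UNIV. \<Sum>t\<in>UNIV.
          phi q j h t * (op_lhs D j h t \<bullet> x) + Phi q j h t * (op_lhs D j h t \<bullet> x)\<^sup>2)
      = (\<Sum>g\<in>UNIV. \<Sum>j\<in>UNIV. \<Sum>h\<in>UNIV. \<Sum>t\<in>UNIV.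
          phi q j h t * (op_lhs D j h t \<bullet> y g) + Phi q j h t * (op_lhs D j h t \<bullet> y g)\<^sup>2)"
    unfolding op2
    unfolding split[of "op_lhs _ _ _ _"]
    by (subst sum_rotate4[symmetric]) (simp add: sum_distrib_left sum.distrib)
  have del: "(\<Sum>h\<in>UNIV. \<Sum>t\<in>UNIV. del q h t * (x $ (OnOff, h, t) - (x $ (OnOff, h, t))\<^sup>2))
      = (\<Sum>g\<in>UNIV. \<Sum>h\<in>UNIV. \<Sum>t\<in>UNIV.
          del q h t * (y g $ (OnOff, h, t) - (y g $ (OnOff, h, t))\<^sup>2))"
    unfolding bin by (subst sum_rotate3[symmetric]) (simp add: sum_distrib_left)
  show ?thesis
    unfolding reduced_cost_def load op del split[of "cost_vec D"]
    by (simp add: sum_subtractf y_def)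
qed

section \<open>Profits\<close>

text \<open>In the padded vector the operational constraints of \<open>g\<close> take their right-hand sides and those
  of the other generators take the value zero. So the reduced cost charges exactly the constant
  operational revenues that occur in the profit of \<open>g\<close>.\<close>

lemma gen_profit_eq_reduced_cost:
  assumes "uc_instance D" "gen_feasible D g y"
  shows "gen_profit D q f g y
    = (\<Sum>t\<in>UNIV. \<Sum>g'\<in>UNIV - {g}. f g g' t) - reduced_cost D q (embed_gen g y)"
proof -
  let ?x = "embed_gen g y"
  have op: "op_lhs D j h t \<bullet> ?x = (if h = g then op_rhs D j g t else 0)" for j h t
    using assms(2) by (simp add: op_lhs_embed_gen[OF assms(1)] gen_feasible_def)
  have bin: "?x $ (OnOff, h, t) - (?x $ (OnOff, h, t))\<^sup>2 = 0" for h t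
    using assms(2) by (auto simp: gen_feasible_def dest: spec[of _ t])
  have ops: "(\<Sum>j\<in>UNIV. \<Sum>h\<in>UNIV. \<Sum>t\<in>UNIV.
          phi q j h t * (op_lhs D j h t \<bullet> ?x) + Phi q j h t * (op_lhs D j h t \<bullet> ?x)\<^sup>2)
      = (\<Sum>t\<in>UNIV. \<Sum>j\<in>UNIV. phi q j g t * op_rhs D j g t + Phi q j g t * (op_rhs D j g t)\<^sup>2)"
  proof -
    have "(\<Sum>t\<in>UNIV. phi q j h t * (op_lhs D j h t \<bullet> ?x) + Phi q j h t * (op_lhs D j h t \<bullet> ?x)\<^sup>2)
        = (if h = g then \<Sum>t\<in>UNIV. phi q j g t * op_rhs D j g t + Phi q j g t * (op_rhs D j g t)\<^sup>2
           else 0)" for j h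
      by (simp add: op)
    then show ?thesis
      by simp (rule sum.swap)
  qed
  show ?thesis
    unfolding reduced_cost_def ops bin cost_vec_embed_gen load_vec_embed_gen gen_profit_def
    by (simp add: sum.distrib sum_subtractf)
qed

lemma gen_part_feasible:
  assumes "uc_instance D" "uc_feasible D x"
  shows "gen_feasible D g (gen_part g x)"
proof -
  have "gen_part g (op_lhs D j g t) \<bullet> gen_part g x = op_lhs D j g t \<bullet> x" for j t
  proof -
    have "op_lhs D j g t \<bullet> x = (\<Sum>h\<in>UNIV. op_lhs D j g t \<bullet> embed_gen h (gen_part h x))"
      by (simp add: sum_embed_gen_part flip: inner_sum_right)
    then show ?thesis
      by (simp add: op_lhs_embed_gen[OF assms(1)])
  qed
  then show ?thesis
    using assms(2) by (auto simp: gen_feasible_def uc_feasible_def gen_part_def nonneg_vec_def)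
qed

theorem theorem2:
  fixes D :: "('j::finite, 'g::finite, 't::finite) uc_data"
    and x :: "real ^ ('j, 'g, 't) var"
    and X :: "real ^ ('j, 'g, 't) var ^ ('j, 'g, 't) var"
    and q :: "('j, 'g, 't) uc_dual"
    and f :: "'g \<Rightarrow> 'g \<Rightarrow> 't \<Rightarrow> real"
  assumes "uc_instance D"
    and "strong_duality D"
    and "cdp_mechanism D x X q f"
    and "cpp_optimal D x X"
    and "\<And>v w g1 g2 t. g1 \<noteq> g2 \<Longrightarrow> X $ (v, g1, t) $ (w, g2, t) = 0"
  shows "individually_rational D x q f"
proof -
  have feas: "uc_feasible D x" and X: "X = outer x x" and q: "cop_optimal D q"
    using assms(3) by (auto simp: cdp_mechanism_def uc_optimal_def)
  have cop: "cop_feasible D q"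
    using q by (simp add: cop_optimal_def)
  have orth: "x $ (Production, g, t) * x $ (Production, h, t) = 0" if "g \<noteq> h" for g h t
    using assms(5)[OF that, of Production t Production] by (simp add: X outer_def)
  have part: "gen_feasible D g (gen_part g x)" for g
    using gen_part_feasible[OF assms(1) feas] .
  have nonneg: "0 \<le> reduced_cost D q (embed_gen g y)" if "gen_feasible D g y" for g y
    using that by (intro reduced_cost_nonneg[OF cop] nonneg_embed_gen) (simp add: gen_feasible_def)
  have "(\<Sum>g\<in>UNIV. reduced_cost D q (embed_gen g (gen_part g x))) = 0"
    using reduced_cost_optimal[OF assms(2,4) q feas] reduced_cost_split[OF assms(1) orth] by simp
  then have zero: "reduced_cost D q (embed_gen g (gen_part g x)) = 0" for g
    using nonneg[OF part] by (simp add: sum_nonneg_eq_0_iff)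
  show ?thesis
    unfolding individually_rational_def gen_optimal_def
    using part nonneg zero by (simp add: gen_profit_eq_reduced_cost[OF assms(1)])
qed

end
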